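(* Let $0<p\leq 1$, let $k$ be a positive integer, and let $A,B\in\mathcal{B}(\mathcal{H})$ be such that $A$ is normal and $AB$ is $(p,k)$-quasihyponormal. If $B(AA^* )=(AA^* )B$, then $BA$ is $(p,k)$-quasihyponormal.
   Context: $\mathcal{H}$ is a complex Hilbert space and $\mathcal{B}(\mathcal{H})$ is the set of bounded linear operators on $\mathcal{H}$. For $0<p\leq 1$ and a positive integer $k$, an operator $T\in\mathcal{B}(\mathcal{H})$ is $(p,k)$-quasihyponormal if $T^{*k}\big((T^*T)^p-(TT^* )^p\big)T^k\geq 0$. *)

theory Defs
  imports "HOL-Analysis.Analysis" "HOL-Computational_Algebra.Polynomial"
begin

text \<open>
  Complex Hilbert spaces. The real scalar multiplication, the norm and the completeness are those
  of class \<^class>\<open>banach\<close>; the axioms tie them to the complex structure. The inner product is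
  conjugate-linear in its first argument.
\<close>

class chilbert_space = banach +
  fixes scaleC :: "complex \<Rightarrow> 'a \<Rightarrow> 'a"  (infixr "*\<^sub>C" 75)
    and cinner :: "'a \<Rightarrow> 'a \<Rightarrow> complex"
  assumes scaleC_add_right: "c *\<^sub>C (x + y) = c *\<^sub>C x + c *\<^sub>C y"
    and scaleC_add_left: "(c + d) *\<^sub>C x = c *\<^sub>C x + d *\<^sub>C x"
    and scaleC_scaleC: "c *\<^sub>C (d *\<^sub>C x) = (c * d) *\<^sub>C x"
    and scaleC_one: "1 *\<^sub>C x = x"
    and scaleR_scaleC: "r *\<^sub>R x = complex_of_real r *\<^sub>C x"
    and cinner_commute: "cinner x y = cnj (cinner y x)"
    and cinner_add_left: "cinner (x + y) z = cinner x z + cinner y z"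
    and cinner_scaleC_left: "cinner (c *\<^sub>C x) y = cnj c * cinner x y"
    and cinner_ge_zero: "0 \<le> Re (cinner x x)"
    and cinner_eq_zero_iff: "cinner x x = 0 \<longleftrightarrow> x = 0"
    and norm_eq_sqrt_cinner: "norm x = sqrt (Re (cinner x x))"

lemma cinner_scaleC_right: "cinner x (c *\<^sub>C y) = c * cinner x y"
  for x y :: "'a :: chilbert_space"
  by (metis cinner_commute cinner_scaleC_left complex_cnj_cnj complex_cnj_mult)

lemma norm_scaleC: "norm (c *\<^sub>C x) = cmod c * norm x" for x :: "'a :: chilbert_space"
proof -
  have "cinner (c *\<^sub>C x) (c *\<^sub>C x) = of_real ((cmod c)\<^sup>2) * cinner x x"
    by (simp add: cinner_scaleC_left cinner_scaleC_right complex_norm_square mult_ac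
        del: of_real_power)
  then have "Re (cinner (c *\<^sub>C x) (c *\<^sub>C x)) = (cmod c)\<^sup>2 * Re (cinner x x)"
    by (simp del: of_real_power)
  then show ?thesis
    by (simp add: norm_eq_sqrt_cinner real_sqrt_mult)
qed

lemma bounded_linear_scaleC: "bounded_linear (\<lambda>x :: 'a :: chilbert_space. c *\<^sub>C x)"
  by (rule bounded_linear_intro [where K = "cmod c"])
    (simp_all add: scaleC_add_right scaleR_scaleC scaleC_scaleC norm_scaleC mult.commute)

text \<open>
  Elements of \<^typ>\<open>'a \<Rightarrow>\<^sub>L 'a\<close> are only real-linear, so the algebra of bounded operators on the
  complex Hilbert space is the following subset.
\<close>

definition bounded_ops :: "('a :: chilbert_space \<Rightarrow>\<^sub>L 'a) set"  where
  "bounded_ops = {T. \<forall>c x. blinfun_apply T (c *\<^sub>C x) = c *\<^sub>C blinfun_apply T x}"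

lift_definition scale_op :: "complex \<Rightarrow> ('a :: chilbert_space \<Rightarrow>\<^sub>L 'a) \<Rightarrow> ('a \<Rightarrow>\<^sub>L 'a)"
  is "\<lambda>c T x. c *\<^sub>C T x"
  by (rule bounded_linear_compose [OF bounded_linear_scaleC])

primrec op_power :: "('a :: chilbert_space \<Rightarrow>\<^sub>L 'a) \<Rightarrow> nat \<Rightarrow> ('a \<Rightarrow>\<^sub>L 'a)" where
  "op_power T 0 = id_blinfun"
| "op_power T (Suc n) = T o\<^sub>L op_power T n"

definition hadjoint :: "('a :: chilbert_space \<Rightarrow>\<^sub>L 'a) \<Rightarrow> ('a \<Rightarrow>\<^sub>L 'a)" where
  "hadjoint T = (THE S. \<forall>x y. cinner (blinfun_apply S x) y = cinner x (blinfun_apply T y))"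

definition normal_op :: "('a :: chilbert_space \<Rightarrow>\<^sub>L 'a) \<Rightarrow> bool" where
  "normal_op T \<longleftrightarrow> hadjoint T o\<^sub>L T = T o\<^sub>L hadjoint T"

definition positive_op :: "('a :: chilbert_space \<Rightarrow>\<^sub>L 'a) \<Rightarrow> bool" where
  "positive_op T \<longleftrightarrow> (\<forall>x. cinner x (blinfun_apply T x) \<in> \<real>\<^sub>\<ge>\<^sub>0)"

definition op_spectrum :: "('a :: chilbert_space \<Rightarrow>\<^sub>L 'a) \<Rightarrow> complex set" where
  "op_spectrum T =
    {z. \<not> (\<exists>S \<in> bounded_ops. S o\<^sub>L (T - scale_op z id_blinfun) = id_blinfun \<and>
                           (T - scale_op z id_blinfun) o\<^sub>L S = id_blinfun)}"

definition op_poly :: "complex poly \<Rightarrow> ('a :: chilbert_space \<Rightarrow>\<^sub>L 'a) \<Rightarrow> ('a \<Rightarrow>\<^sub>L 'a)" where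
  "op_poly q T = (\<Sum>i\<le>degree q. scale_op (coeff q i) (op_power T i))"

text \<open>
  Continuous functional calculus: \<open>f(T)\<close> is the limit in operator norm of \<open>q\<^sub>n(T)\<close>, for any
  polynomials \<open>q\<^sub>n\<close> converging to \<open>f\<close> uniformly on the spectrum of \<open>T\<close>. This is meaningful for
  self-adjoint \<open>T\<close> and \<open>f\<close> continuous on the spectrum (which is then real, so that such
  polynomials exist); it is only used for positive \<open>T\<close>.
\<close>

definition op_cfc :: "(complex \<Rightarrow> complex) \<Rightarrow> ('a :: chilbert_space \<Rightarrow>\<^sub>L 'a) \<Rightarrow> ('a \<Rightarrow>\<^sub>L 'a)" where
  "op_cfc f T =
    (THE S. \<forall>q :: nat \<Rightarrow> complex poly.
       uniform_limit (op_spectrum T) (\<lambda>n. poly (q n)) f sequentially \<longrightarrow>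
       (\<lambda>n. op_poly (q n) T) \<longlonglongrightarrow> S)"

definition op_powr :: "('a :: chilbert_space \<Rightarrow>\<^sub>L 'a) \<Rightarrow> real \<Rightarrow> ('a \<Rightarrow>\<^sub>L 'a)" where
  "op_powr T p = op_cfc (\<lambda>z. complex_of_real (Re z powr p)) T"

definition quasihyponormal :: "real \<Rightarrow> nat \<Rightarrow> ('a :: chilbert_space \<Rightarrow>\<^sub>L 'a) \<Rightarrow> bool" where
  "quasihyponormal p k T \<longleftrightarrow>
    positive_op (op_power (hadjoint T) k o\<^sub>L
      (op_powr (hadjoint T o\<^sub>L T) p - op_powr (T o\<^sub>L hadjoint T) p) o\<^sub>L op_power T k)"

end

theory Submission
  imports Defs "HOL-Computational_Algebra.Fundamental_Theorem_Algebra"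
begin

text \<open>
  Conceptually, \<open>A B\<close> and \<open>B A\<close> are unitarily equivalent: write the normal operator as \<open>A = U P\<close> with
  \<open>U\<close> unitary, commuting with the modulus \<open>P\<close> of \<open>A\<close>; as \<open>B\<close> commutes with \<open>P\<^sup>2 = A A\<^sup>*\<close> and hence with \<open>P\<close>,
  one has \<open>U\<^sup>* (A B) U = P B U = B P U = B A\<close>. The proof below uses \<open>A\<close> itself in place of the
  unitary \<open>U\<close>, so that no polar decomposition has to be built.

  Put \<open>S = A B\<close> and \<open>T = B A\<close>. Then \<open>A T = S A\<close>, and normality together with the commutation hypothesis
  gives \<open>A T\<^sup>* = S\<^sup>* A\<close>. Thus \<open>A\<close> intertwines every expression in \<open>T, T\<^sup>*\<close> with the same
  expression in \<open>S, S\<^sup>*\<close>, and in particular the operators \<open>Q\<close> and \<open>Q'\<close> whose positivity expresses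
  quasihyponormality of \<open>T\<close> and of \<open>S\<close> (lemma \<open>hyponormality_form_intertwine\<close>). Since \<open>Q' \<ge> 0\<close>, the
  product \<open>A\<^sup>* A Q = A\<^sup>* Q' A\<close> is positive, and its factors commute; hence \<open>Q\<close> is positive on the range of
  \<open>A\<^sup>* A\<close>. Because \<open>T\<^sup>k\<close> with \<open>k > 0\<close> factors through \<open>A\<close>, the form of \<open>Q\<close> sees a vector \<open>x\<close> only
  through \<open>A x\<close>, and a density argument concludes (lemma \<open>quasihyponormal_transfer\<close>).

  What carries this is the functional calculus for a positive operator \<open>M\<close>. The Riesz representation
  theorem yields adjoints, and the Lax--Milgram theorem (\<open>coercive_invertible\<close>) confines the spectrum of
  \<open>M\<close> to the interval from \<open>0\<close> to the norm of \<open>M\<close>. The norm of \<open>q(M)\<close> is at most the supremum of the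
  absolute value of \<open>q\<close> on the spectrum (\<open>norm_op_poly_le\<close>), because \<open>q(M)\<^sup>* q(M) - c\<^sup>2\<close> is never
  invertible for \<open>c\<close> the norm of \<open>q(M)\<close>, while its linear factors are invertible off the spectrum. With
  Weierstrass approximation this shows that powers of \<open>M\<close> are well defined and are limits of polynomials in
  \<open>M\<close> (\<open>op_cfc_limit\<close>), so they inherit intertwining relations (\<open>op_powr_intertwine\<close>).
\<close>

section \<open>Inner product geometry\<close>

lemma cinner_self: "cinner x x = of_real ((norm x)\<^sup>2)" for x :: "'a :: chilbert_space"
proof -
  have "Im (cinner x x) = 0"
    using arg_cong[OF cinner_commute[of x x], of Im] by simp
  moreover have "Re (cinner x x) = (norm x)\<^sup>2"
    by (simp add: norm_eq_sqrt_cinner cinner_ge_zero)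
  ultimately show ?thesis
    by (simp add: complex_eq_iff)
qed

lemma cinner_add_right: "cinner x (y + z) = cinner x y + cinner x z"
  for x y z :: "'a :: chilbert_space"
  by (metis cinner_add_left cinner_commute complex_cnj_add)

lemma scaleC_zero_left: "0 *\<^sub>C x = 0" for x :: "'a :: chilbert_space"
  using scaleR_scaleC[of 0 x] by simp

lemma scaleC_minus_left: "(- c) *\<^sub>C x = - (c *\<^sub>C x)" for x :: "'a :: chilbert_space"
proof -
  have "(- c) *\<^sub>C x + c *\<^sub>C x = 0 *\<^sub>R x"
    unfolding scaleR_scaleC scaleC_add_left[symmetric] by simp
  then show ?thesis
    by (simp add: eq_neg_iff_add_eq_0)
qed

text \<open>
  The expansion behind both the Cauchy--Schwarz inequality (with \<open>c\<close> the projection coefficient)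
  and the contraction estimate for coercive operators.
\<close>

lemma norm_diff_scaleC_sq:
  "(norm (x - c *\<^sub>C y))\<^sup>2 = (norm x)\<^sup>2 - 2 * Re (c * cinner x y) + (cmod c)\<^sup>2 * (norm y)\<^sup>2"
  for x y :: "'a :: chilbert_space"
proof -
  have eq: "x - c *\<^sub>C y = x + (- c) *\<^sub>C y"
    by (simp add: scaleC_minus_left)
  have "of_real ((norm (x - c *\<^sub>C y))\<^sup>2)
      = cinner x x + cinner x ((- c) *\<^sub>C y) + cinner ((- c) *\<^sub>C y) x
        + cinner ((- c) *\<^sub>C y) ((- c) *\<^sub>C y)"
    unfolding cinner_self[symmetric] eq by (simp only: cinner_add_left cinner_add_right add_ac)
  also have "\<dots> = of_real ((norm x)\<^sup>2) - (c * cinner x y + cnj (c * cinner x y))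
        + of_real ((cmod c)\<^sup>2) * of_real ((norm y)\<^sup>2)"
    unfolding cinner_scaleC_left cinner_scaleC_right cinner_self complex_norm_square[symmetric]
      complex_cnj_mult cinner_commute[of y x]
    by (simp add: norm_scaleC power_mult_distrib norm_minus_cancel algebra_simps)
  finally show ?thesis
    by (simp add: complex_eq_iff)
qed

lemma cauchy_schwarz: "cmod (cinner x y) \<le> norm x * norm y" for x y :: "'a :: chilbert_space"
proof (cases "y = 0")
  case True
  have "cinner x (0 *\<^sub>C y) = 0 * cinner x y"
    by (rule cinner_scaleC_right)
  then show ?thesis
    using True by (simp add: scaleC_zero_left)
next
  case False
  \<comment> \<open>With this coefficient \<open>c *\<^sub>C y\<close> is the orthogonal projection of \<open>x\<close> onto the line through \<open>y\<close>.\<close>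
  define c where "c = cnj (cinner x y) / of_real ((norm y)\<^sup>2)"
  have "c * cinner x y = of_real ((cmod (cinner x y))\<^sup>2 / (norm y)\<^sup>2)"
    unfolding c_def of_real_divide complex_norm_square by simp
  then have re: "Re (c * cinner x y) = (cmod (cinner x y))\<^sup>2 / (norm y)\<^sup>2"
    by (simp del: of_real_divide of_real_power)
  have "(cmod c)\<^sup>2 * (norm y)\<^sup>2 = (cmod (cinner x y))\<^sup>2 / (norm y)\<^sup>2"
    using False unfolding c_def by (simp add: norm_divide power_divide power2_eq_square norm_mult)
  then have "0 \<le> (norm x)\<^sup>2 - (cmod (cinner x y))\<^sup>2 / (norm y)\<^sup>2"
    using norm_diff_scaleC_sq[of x c y] re zero_le_power2[of "norm (x - c *\<^sub>C y)"] by simp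
  then have "(cmod (cinner x y))\<^sup>2 \<le> (norm x * norm y)\<^sup>2"
    using False by (simp add: field_simps power_mult_distrib)
  then show ?thesis
    by (rule power2_le_imp_le) simp
qed

interpretation cinner: bounded_bilinear "cinner :: 'a :: chilbert_space \<Rightarrow> 'a \<Rightarrow> complex"
proof
  show "\<exists>K. \<forall>a b :: 'a. norm (cinner a b) \<le> norm a * norm b * K"
    by (intro exI[of _ 1]) (simp add: cauchy_schwarz)
qed (simp_all add: cinner_add_left cinner_add_right scaleR_scaleC cinner_scaleC_left
    cinner_scaleC_right scaleR_conv_of_real)

lemma norm_diff_sq: "(norm (x - y))\<^sup>2 = (norm x)\<^sup>2 - 2 * Re (cinner x y) + (norm y)\<^sup>2"
  for x y :: "'a :: chilbert_space"
  using norm_diff_scaleC_sq[of x 1 y] by (simp add: scaleC_one)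

lemma norm_add_sq: "(norm (x + y))\<^sup>2 = (norm x)\<^sup>2 + 2 * Re (cinner x y) + (norm y)\<^sup>2"
  for x y :: "'a :: chilbert_space"
  using norm_diff_sq[of x "- y"] by (simp add: cinner.minus_right)

lemma cinner_ext: "(\<And>y. cinner x y = cinner x' y) \<Longrightarrow> x = x'" for x x' :: "'a :: chilbert_space"
  by (metis cinner.diff_left cinner_eq_zero_iff right_minus_eq)

section \<open>Riesz representation and adjoints\<close>

text \<open>
  The representing vector is the minimiser of \<open>J x = (norm x)\<^sup>2 - 2 * g x\<close>. A minimising sequence is
  Cauchy by the parallelogram law, so it converges by completeness, and the first-order condition
  at the limit \<open>z\<close> in direction \<open>w\<close> reads \<open>Re (cinner z w) = g w\<close>.
\<close>

lemma riesz_representation_real: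
  fixes g :: "'a :: chilbert_space \<Rightarrow> real"
  assumes "bounded_linear g"
  shows "\<exists>z. \<forall>w. Re (cinner z w) = g w"
proof -
  interpret g: bounded_linear g by fact
  define J where "J x = (norm x)\<^sup>2 - 2 * g x" for x
  obtain K where K: "K \<ge> 0" "\<And>x. \<bar>g x\<bar> \<le> norm x * K"
    using g.nonneg_bounded by (auto simp: real_norm_def)
  have J_lower: "- K\<^sup>2 \<le> J x" for x
  proof -
    have "0 \<le> (norm x - K)\<^sup>2"
      by simp
    then show ?thesis
      using K(2)[of x] unfolding J_def by (simp add: power2_diff)
  qed
  define I where "I = Inf (range J)"
  have bdd: "bdd_below (range J)"
    using J_lower by (intro bdd_belowI[of _ "- K\<^sup>2"]) auto
  have I_le: "I \<le> J x" for x
    unfolding I_def using bdd by (simp add: cInf_lower)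
  have "\<exists>x. J x < I + 1 / real (Suc n)" for n
    using cInf_lessD[of "range J" "I + 1 / real (Suc n)"] unfolding I_def by auto
  then obtain s where s: "\<And>n. J (s n) < I + 1 / real (Suc n)"
    by metis
  \<comment> \<open>The parallelogram law turns near-minimality of two points into closeness.\<close>
  have close: "(norm (x - y))\<^sup>2 \<le> 2 * (J x - I) + 2 * (J y - I)" for x y
  proof -
    have "J ((1/2) *\<^sub>R (x + y)) = (norm (x + y))\<^sup>2 / 4 - (g x + g y)"
      unfolding J_def g.scaleR g.add norm_scaleR by (simp add: power_divide add_divide_distrib)
    then have "I \<le> (norm (x + y))\<^sup>2 / 4 - (g x + g y)"
      using I_le[of "(1/2) *\<^sub>R (x + y)"] by linarith
    then show ?thesis
      unfolding J_def norm_diff_sq norm_add_sq by argo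
  qed
  have "Cauchy s"
  proof (rule metric_CauchyI)
    fix e :: real assume "e > 0"
    then obtain N where N: "inverse (real (Suc N)) < e\<^sup>2 / 4"
      using reals_Archimedean[of "e\<^sup>2 / 4"] by auto
    have small: "J (s n) - I < e\<^sup>2 / 4" if "n \<ge> N" for n
    proof -
      have "1 / real (Suc n) \<le> inverse (real (Suc N))"
        using that by (simp add: field_simps)
      then show ?thesis
        using s[of n] N by linarith
    qed
    have "dist (s m) (s n) < e" if "m \<ge> N" "n \<ge> N" for m n
    proof -
      have "(norm (s m - s n))\<^sup>2 < e\<^sup>2"
        using close[of "s m" "s n"] small[OF that(1)] small[OF that(2)] by argo
      then show ?thesis
        using \<open>e > 0\<close> by (simp add: dist_norm power2_less_imp_less)
    qed
    then show "\<exists>M. \<forall>m\<ge>M. \<forall>n\<ge>M. dist (s m) (s n) < e"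
      by blast
  qed
  then obtain z where z: "s \<longlonglongrightarrow> z"
    by (metis Cauchy_convergent_iff convergent_def)
  have "(\<lambda>n. J (s n)) \<longlonglongrightarrow> J z"
    unfolding J_def by (intro tendsto_intros z g.tendsto)
  moreover have "(\<lambda>n. I + 1 / real (Suc n)) \<longlonglongrightarrow> I + 0"
    by (intro tendsto_intros LIMSEQ_Suc[OF lim_1_over_n])
  ultimately have "J z \<le> I + 0"
    by (rule LIMSEQ_le) (use s less_imp_le in blast)
  then have Jz: "J z \<le> J x" for x
    using I_le[of x] by linarith
  have "Re (cinner z w) = g w" for w
  proof -
    define d where "d = Re (cinner z w) - g w"
    have quad: "0 \<le> 2 * t * d + t\<^sup>2 * (norm w)\<^sup>2" for t
      using Jz[of "z + t *\<^sub>R w"] unfolding J_def d_def norm_add_sq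
      by (simp add: g.add g.scaleR cinner.scaleR_right power_mult_distrib algebra_simps)
    \<comment> \<open>Minimising the quadratic in \<open>t\<close> suggests \<open>t = - d / (norm w)\<^sup>2\<close>; the added \<open>1\<close> covers \<open>w = 0\<close>.\<close>
    define m where "m = (norm w)\<^sup>2 + 1"
    have m: "m > 0"
      by (simp add: m_def add_nonneg_pos)
    have "0 \<le> 2 * (- d / m) * d + (- d / m)\<^sup>2 * (m - 1)"
      using quad[of "- d / m"] by (simp add: m_def)
    also have "\<dots> = - (d\<^sup>2 * (m + 1)) / m\<^sup>2"
      using m by (simp add: field_simps power2_eq_square)
    finally have "d\<^sup>2 * (m + 1) \<le> 0"
      using m by (simp add: field_simps)
    then have "d = 0"
      using m by (simp add: mult_le_0_iff)
    then show ?thesis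
      by (simp add: d_def)
  qed
  then show ?thesis
    by blast
qed

text \<open>
  The real parts determine a complex-linear functional: its imaginary part at \<open>w\<close> is read off from
  its real part at \<open>\<i> *\<^sub>C w\<close>.
\<close>

lemma riesz_representation:
  fixes \<phi> :: "'a :: chilbert_space \<Rightarrow> complex"
  assumes "bounded_linear \<phi>" and hom: "\<And>c x. \<phi> (c *\<^sub>C x) = c * \<phi> x"
  shows "\<exists>z. \<forall>w. cinner z w = \<phi> w"
proof -
  have "bounded_linear (\<lambda>x. Re (\<phi> x))"
    using assms(1) bounded_linear_Re bounded_linear_compose by blast
  then obtain z where z: "\<And>w. Re (cinner z w) = Re (\<phi> w)"
    using riesz_representation_real by blast
  have "cinner z w = \<phi> w" for w
    using z[of w] z[of "\<i> *\<^sub>C w"] by (simp add: hom cinner_scaleC_right complex_eq_iff)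
  then show ?thesis
    by blast
qed

lemma compose_eq_apply:
  "U o\<^sub>L V = U' o\<^sub>L V' \<Longrightarrow> blinfun_apply U (blinfun_apply V x) = blinfun_apply U' (blinfun_apply V' x)"
  by (metis blinfun_apply_blinfun_compose)

lemma bounded_opsD: "T \<in> bounded_ops \<Longrightarrow> blinfun_apply T (c *\<^sub>C x) = c *\<^sub>C blinfun_apply T x"
  by (simp add: bounded_ops_def)

lemma bounded_ops_compose: "S \<in> bounded_ops \<Longrightarrow> T \<in> bounded_ops \<Longrightarrow> S o\<^sub>L T \<in> bounded_ops"
  by (simp add: bounded_ops_def)

lemma scaleC_diff_right: "c *\<^sub>C (x - y) = c *\<^sub>C x - c *\<^sub>C y" for x y :: "'a :: chilbert_space"
  using linear_diff[OF bounded_linear.linear[OF bounded_linear_scaleC]] by blast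

lemma scaleC_zero_right: "c *\<^sub>C (0 :: 'a :: chilbert_space) = 0"
  using linear_0[OF bounded_linear.linear[OF bounded_linear_scaleC]] by blast

lemma bounded_ops_add: "S \<in> bounded_ops \<Longrightarrow> T \<in> bounded_ops \<Longrightarrow> S + T \<in> bounded_ops"
  by (simp add: bounded_ops_def blinfun.add_left scaleC_add_right)

lemma bounded_ops_diff: "S \<in> bounded_ops \<Longrightarrow> T \<in> bounded_ops \<Longrightarrow> S - T \<in> bounded_ops"
  by (simp add: bounded_ops_def blinfun.diff_left scaleC_diff_right)

lemma bounded_ops_id: "id_blinfun \<in> bounded_ops"
  by (simp add: bounded_ops_def)

lemma bounded_ops_scale_op: "T \<in> bounded_ops \<Longrightarrow> scale_op c T \<in> bounded_ops"
  by (simp add: bounded_ops_def scale_op.rep_eq scaleC_scaleC mult.commute)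

lemma bounded_ops_power: "T \<in> bounded_ops \<Longrightarrow> op_power T n \<in> bounded_ops"
  by (induction n) (simp_all add: bounded_ops_id bounded_ops_compose)

lemma closed_bounded_ops: "closed (bounded_ops :: ('a :: chilbert_space \<Rightarrow>\<^sub>L 'a) set)"
proof -
  have "bounded_ops = (\<Inter>c. \<Inter>x. {T :: 'a \<Rightarrow>\<^sub>L 'a. T (c *\<^sub>C x) = c *\<^sub>C T x})"
    by (auto simp: bounded_ops_def)
  moreover have "closed {T :: 'a \<Rightarrow>\<^sub>L 'a. T (c *\<^sub>C x) = c *\<^sub>C T x}" for c x
    by (intro closed_Collect_eq continuous_intros
        bounded_linear.continuous_on[OF bounded_linear_scaleC])
  ultimately show ?thesis
    by (metis (no_types, lifting) closed_INT)
qed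

text \<open>
  For fixed \<open>x\<close> the functional \<open>y \<mapsto> cinner x (T y)\<close> is represented by a unique vector, which is the
  value of the adjoint at \<open>x\<close>; uniqueness makes that value depend linearly on \<open>x\<close>.
\<close>

lemma adjoint_exists:
  fixes T :: "'a :: chilbert_space \<Rightarrow>\<^sub>L 'a"
  assumes T: "T \<in> bounded_ops"
  shows "\<exists>S \<in> bounded_ops. \<forall>x y. cinner (blinfun_apply S x) y = cinner x (blinfun_apply T y)"
proof -
  have "\<exists>z. \<forall>w. cinner z w = cinner x (T w)" for x
  proof (rule riesz_representation)
    show "bounded_linear (\<lambda>w. cinner x (T w))"
      by (intro bounded_linear_compose[OF cinner.bounded_linear_right]
          blinfun.bounded_linear_right)
  qed (simp add: bounded_opsD[OF T] cinner_scaleC_right)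
  then obtain s where s: "\<And>x w. cinner (s x) w = cinner x (T w)"
    by metis
  have norm_s: "norm (s x) \<le> norm x * norm T" for x
  proof -
    have "(norm (s x))\<^sup>2 = cmod (cinner (s x) (s x))"
      by (simp add: cinner_self del: of_real_power)
    also have "\<dots> \<le> norm x * norm (T (s x))"
      unfolding s by (rule cauchy_schwarz)
    also have "\<dots> \<le> norm x * (norm T * norm (s x))"
      by (intro mult_left_mono norm_blinfun) simp
    finally show ?thesis
      by (cases "norm (s x) = 0") (auto simp: power2_eq_square)
  qed
  have "bounded_linear s"
    by (rule bounded_linear_intro[OF _ _ norm_s];
        rule cinner_ext; simp add: s cinner_add_left cinner.scaleR_left)
  moreover have "s (c *\<^sub>C x) = c *\<^sub>C s x" for c x
    by (rule cinner_ext) (simp add: s cinner_scaleC_left)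
  ultimately show ?thesis
    by (intro bexI[of _ "Blinfun s"])
      (simp_all add: bounded_ops_def bounded_linear_Blinfun_apply s)
qed

lemma
  fixes T :: "'a :: chilbert_space \<Rightarrow>\<^sub>L 'a"
  assumes T: "T \<in> bounded_ops"
  shows hadjoint_in_bounded_ops: "hadjoint T \<in> bounded_ops"
    and cinner_hadjoint_left: "cinner (blinfun_apply (hadjoint T) x) y = cinner x (blinfun_apply T y)"
proof -
  obtain S where S: "S \<in> bounded_ops" "\<forall>x y. cinner (S x) y = cinner x (T y)"
    using adjoint_exists[OF T] by blast
  have "hadjoint T = S"
    unfolding hadjoint_def
  proof (rule the_equality, rule S(2))
    fix S' assume S': "\<forall>x y. cinner (blinfun_apply S' x) y = cinner x (T y)"
    have "S' x = S x" for x
      by (rule cinner_ext) (simp add: S S')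
    then show "S' = S"
      by (rule blinfun_eqI)
  qed
  then show "hadjoint T \<in> bounded_ops" "cinner (hadjoint T x) y = cinner x (T y)"
    using S by auto
qed

lemma cinner_hadjoint_right:
  "T \<in> bounded_ops \<Longrightarrow> cinner x (blinfun_apply (hadjoint T) y) = cinner (blinfun_apply T x) y"
  by (metis cinner_commute cinner_hadjoint_left)

lemma hadjoint_unique:
  assumes "T \<in> bounded_ops" "\<And>x y. cinner (blinfun_apply S x) y = cinner x (blinfun_apply T y)"
  shows "hadjoint T = S"
  by (rule blinfun_eqI, rule cinner_ext) (simp add: cinner_hadjoint_left assms)

lemma hadjoint_compose:
  "S \<in> bounded_ops \<Longrightarrow> T \<in> bounded_ops \<Longrightarrow> hadjoint (S o\<^sub>L T) = hadjoint T o\<^sub>L hadjoint S"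
  by (rule hadjoint_unique) (simp_all add: bounded_ops_compose cinner_hadjoint_left)

lemma hadjoint_hadjoint: "T \<in> bounded_ops \<Longrightarrow> hadjoint (hadjoint T) = T"
  by (rule hadjoint_unique) (simp_all add: hadjoint_in_bounded_ops cinner_hadjoint_right)

section \<open>Coercive operators and the spectrum of a positive operator\<close>

text \<open>
  The Lax--Milgram theorem. To solve \<open>N x = y\<close>, iterate \<open>x \<mapsto> x - b *\<^sub>C (N x - y)\<close> with \<open>b\<close> a small
  multiple of \<open>\<zeta>\<close>: coercivity makes this a contraction. The phase \<open>\<zeta>\<close> allows the numerical range of
  \<open>N\<close> to lie in any half-plane away from the origin, so that one statement excludes every point
  outside an interval from the spectrum of a positive operator.
\<close>

lemma coercive_invertible:
  fixes N :: "'a :: chilbert_space \<Rightarrow>\<^sub>L 'a"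
  assumes N: "N \<in> bounded_ops" and c: "c > 0" and \<zeta>: "cmod \<zeta> = 1"
    and coercive: "\<And>x. c * (norm x)\<^sup>2 \<le> Re (\<zeta> * cinner x (blinfun_apply N x))"
  shows "\<exists>S \<in> bounded_ops. S o\<^sub>L N = id_blinfun \<and> N o\<^sub>L S = id_blinfun"
proof -
  have below: "c * norm x \<le> norm (N x)" for x
  proof -
    have "c * (norm x)\<^sup>2 \<le> cmod (\<zeta> * cinner x (N x))"
      using coercive[of x] complex_Re_le_cmod order_trans by blast
    also have "\<dots> \<le> norm x * norm (N x)"
      by (simp add: norm_mult \<zeta> cauchy_schwarz)
    finally show ?thesis
      by (cases "norm x = 0") (auto simp: power2_eq_square)
  qed
  \<comment> \<open>An upper bound for the norm of \<open>N\<close>; adding \<open>c\<close> keeps \<open>c / K \<le> 1\<close>, so that \<open>q\<close> below is real.\<close>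
  define K where "K = norm N + c"
  have K: "K \<ge> c" "K > 0"
    using c by (simp_all add: K_def add_nonneg_pos)
  \<comment> \<open>The minimiser of the squared contraction factor \<open>1 - 2 * t * c + t\<^sup>2 * K\<^sup>2\<close>.\<close>
  define t where "t = c / K\<^sup>2"
  have t: "t > 0"
    using c K by (simp add: t_def)
  define q where "q = sqrt (1 - (c / K)\<^sup>2)"
  have "(c / K)\<^sup>2 \<le> 1" "(c / K)\<^sup>2 > 0"
    using c K by (simp_all add: power_le_one)
  then have q: "0 \<le> q" "q < 1" "q\<^sup>2 = 1 - (c / K)\<^sup>2"
    by (simp_all add: q_def)
  define b where "b = of_real t * \<zeta>"
  have contr: "norm (x - b *\<^sub>C N x) \<le> q * norm x" for x
  proof -
    have "(norm (x - b *\<^sub>C N x))\<^sup>2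
        = (norm x)\<^sup>2 - 2 * t * Re (\<zeta> * cinner x (N x)) + t\<^sup>2 * (norm (N x))\<^sup>2"
      unfolding norm_diff_scaleC_sq using t by (simp add: b_def norm_mult \<zeta> mult.assoc algebra_simps)
    also have "\<dots> \<le> (norm x)\<^sup>2 - 2 * t * (c * (norm x)\<^sup>2) + t\<^sup>2 * (K * norm x)\<^sup>2"
    proof -
      have "norm (N x) \<le> K * norm x"
        using norm_blinfun[of N x] c unfolding K_def by (simp add: distrib_right add_increasing2)
      then have "t\<^sup>2 * (norm (N x))\<^sup>2 \<le> t\<^sup>2 * (K * norm x)\<^sup>2"
        by (intro mult_left_mono power_mono) auto
      moreover have "2 * t * (c * (norm x)\<^sup>2) \<le> 2 * t * Re (\<zeta> * cinner x (N x))"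
        using t coercive by (intro mult_left_mono) auto
      ultimately show ?thesis
        by linarith
    qed
    also have "\<dots> = (q * norm x)\<^sup>2"
      using K unfolding power_mult_distrib q t_def by (simp add: field_simps power2_eq_square)
    finally show ?thesis
      by (rule power2_le_imp_le) (simp add: q)
  qed
  have b0: "b \<noteq> 0"
    using t \<zeta> by (auto simp: b_def)
  have "\<exists>x. N x = y" for y
  proof -
    have "\<exists>!x. x - b *\<^sub>C (N x - y) = x"
    proof (rule banach_fix_type[OF q(1,2)], intro allI)
      fix x x'
      have "x - b *\<^sub>C (N x - y) - (x' - b *\<^sub>C (N x' - y)) = (x - x') - b *\<^sub>C N (x - x')"
        by (simp add: blinfun.diff_right scaleC_diff_right algebra_simps)
      then show "dist (x - b *\<^sub>C (N x - y)) (x' - b *\<^sub>C (N x' - y)) \<le> q * dist x x'"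
        using contr[of "x - x'"] by (simp only: dist_norm)
    qed
    then obtain x where "x - b *\<^sub>C (N x - y) = x"
      by blast
    then have "b *\<^sub>C (N x - y) = 0"
      by simp
    then have "cmod b * norm (N x - y) = 0"
      unfolding norm_scaleC[symmetric] by simp
    then have "N x = y"
      using b0 by simp
    then show ?thesis ..
  qed
  then obtain s where s: "\<And>y. N (s y) = y"
    by metis
  have inj: "x = x'" if "N x = N x'" for x x'
    using below[of "x - x'"] that c by (simp add: blinfun.diff_right mult_le_0_iff)
  have "bounded_linear s"
  proof (rule bounded_linear_intro)
    show "norm (s y) \<le> norm y * (1 / c)" for y
      using below[of "s y"] c by (simp add: s field_simps)
  qed (rule inj, simp add: s blinfun.add_right blinfun.scaleR_right)+
  moreover have "s (d *\<^sub>C y) = d *\<^sub>C s y" for d y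
    by (rule inj) (simp add: s bounded_opsD[OF N])
  moreover have "s (N x) = x" for x
    by (rule inj) (simp add: s)
  ultimately show ?thesis
    by (intro bexI[of _ "Blinfun s"])
      (auto intro!: blinfun_eqI simp: bounded_ops_def bounded_linear_Blinfun_apply s)
qed

lemma positive_opD:
  "positive_op M \<Longrightarrow> cinner x (blinfun_apply M x) = of_real (Re (cinner x (blinfun_apply M x)))"
  "positive_op M \<Longrightarrow> 0 \<le> Re (cinner x (blinfun_apply M x))"
  unfolding positive_op_def by (auto simp: complex_nonneg_Reals_iff complex_eq_iff)

text \<open>
  Polarisation: a real quadratic form, evaluated at \<open>x + y\<close> and at \<open>x + \<i> *\<^sub>C y\<close>, forces the
  sesquilinear form to be Hermitian.
\<close>

lemma positive_op_symmetric:
  fixes M :: "'a :: chilbert_space \<Rightarrow>\<^sub>L 'a"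
  assumes M: "M \<in> bounded_ops" and pos: "positive_op M"
  shows "cinner (blinfun_apply M x) y = cinner x (blinfun_apply M y)"
proof -
  have real: "Im (cinner z (M z)) = 0" for z
    by (subst positive_opD(1)[OF pos]) simp
  have Im0: "Im (cinner u (M v) + cinner v (M u)) = 0" for u v
    using real[of "u + v"] real[of u] real[of v]
    by (simp add: blinfun.add_right cinner_add_left cinner_add_right)
  have "cinner y (M x) = cnj (cinner x (M y))"
    using Im0[of x y] Im0[of x "\<i> *\<^sub>C y"]
    by (simp add: bounded_opsD[OF M] cinner_scaleC_right cinner_scaleC_left complex_eq_iff)
  then show ?thesis
    using cinner_commute[of "M x" y] by simp
qed

lemma positive_hadjoint_compose:
  assumes "X \<in> bounded_ops"
  shows "positive_op (hadjoint X o\<^sub>L X)"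
  unfolding positive_op_def using assms
  by (simp add: cinner_hadjoint_right cinner_self del: of_real_power)

text \<open>
  For \<open>\<mu>\<close> off the interval one of the phases \<open>\<plusminus>\<i>\<close>, \<open>1\<close>, \<open>- 1\<close> makes \<open>M - \<mu>\<close> coercive, according to
  whether \<open>\<mu>\<close> is not real, negative, or larger than the norm of \<open>M\<close>.
\<close>

lemma op_spectrum_positive:
  fixes M :: "'a :: chilbert_space \<Rightarrow>\<^sub>L 'a"
  assumes M: "M \<in> bounded_ops" and pos: "positive_op M"
  shows "op_spectrum M \<subseteq> of_real ` {0..norm M}"
proof
  fix \<mu> assume \<mu>: "\<mu> \<in> op_spectrum M"
  define N where "N = M - scale_op \<mu> id_blinfun"
  have N: "N \<in> bounded_ops"
    unfolding N_def by (intro bounded_ops_diff bounded_ops_scale_op bounded_ops_id M)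
  have form: "cinner x (N x) = of_real (Re (cinner x (M x))) - \<mu> * of_real ((norm x)\<^sup>2)" for x
    using positive_opD(1)[OF pos, of x]
    by (simp add: N_def blinfun.diff_left scale_op.rep_eq cinner.diff_right cinner_scaleC_right
        cinner_self del: of_real_power)
  have no_coercive: False
    if "c > 0" "cmod \<zeta> = 1" "\<And>x. c * (norm x)\<^sup>2 \<le> Re (\<zeta> * cinner x (N x))" for c \<zeta>
    using coercive_invertible[OF N that] \<mu> by (auto simp: op_spectrum_def N_def)
  have "Im \<mu> = 0"
  proof (rule ccontr)
    assume "Im \<mu> \<noteq> 0"
    then show False
      by (intro no_coercive[of "\<bar>Im \<mu>\<bar>" "\<i> * of_real (sgn (Im \<mu>))"])
        (auto simp: form norm_mult sgn_if)
  qed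
  moreover have "0 \<le> Re \<mu>"
  proof (rule ccontr)
    assume "\<not> 0 \<le> Re \<mu>"
    then show False
      by (intro no_coercive[of "- Re \<mu>" 1]) (simp_all add: form positive_opD(2)[OF pos])
  qed
  moreover have "Re \<mu> \<le> norm M"
  proof (rule ccontr)
    assume *: "\<not> Re \<mu> \<le> norm M"
    have "Re (cinner x (M x)) \<le> norm M * (norm x)\<^sup>2" for x
    proof -
      have "Re (cinner x (M x)) \<le> norm x * norm (M x)"
        using complex_Re_le_cmod cauchy_schwarz order_trans by blast
      also have "\<dots> \<le> norm x * (norm M * norm x)"
        by (intro mult_left_mono norm_blinfun) simp
      finally show ?thesis
        by (simp add: power2_eq_square mult_ac)
    qed
    with * show False
      by (intro no_coercive[of "Re \<mu> - norm M" "- 1"]) (simp_all add: form algebra_simps)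
  qed
  ultimately have "\<mu> = of_real (Re \<mu>)" "Re \<mu> \<in> {0..norm M}"
    by (simp_all add: complex_eq_iff)
  then show "\<mu> \<in> of_real ` {0..norm M}"
    by blast
qed

section \<open>Polynomials in an operator\<close>

lemma op_poly_eq_sum:
  "degree q \<le> n \<Longrightarrow> op_poly q T = (\<Sum>i\<le>n. scale_op (coeff q i) (op_power T i))"
proof -
  assume n: "degree q \<le> n"
  have zero: "scale_op 0 S = 0" for S :: "'a \<Rightarrow>\<^sub>L 'a"
    by (intro blinfun_eqI) (simp add: scale_op.rep_eq scaleC_zero_left)
  show ?thesis
    unfolding op_poly_def using n
    by (intro sum.mono_neutral_left) (auto simp: coeff_eq_0 zero)
qed

lemma op_poly_add: "op_poly (p + q) T = op_poly p T + op_poly q T"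
proof -
  define n where "n = max (degree p) (degree q)"
  have "degree p \<le> n" "degree q \<le> n" "degree (p + q) \<le> n"
    by (simp_all add: n_def degree_add_le_max)
  moreover have "scale_op (c + d) S = scale_op c S + scale_op d S" for c d and S :: "'a \<Rightarrow>\<^sub>L 'a"
    by (rule blinfun_eqI) (simp add: scale_op.rep_eq blinfun.add_left scaleC_add_left)
  ultimately show ?thesis
    by (simp add: op_poly_eq_sum sum.distrib)
qed

lemma scale_op_sum:
  fixes S :: "'i \<Rightarrow> 'a :: chilbert_space \<Rightarrow>\<^sub>L 'a"
  shows "scale_op c (\<Sum>i\<in>I. S i) = (\<Sum>i\<in>I. scale_op c (S i))"
proof (cases "finite I")
  case True
  have add: "scale_op c (0 :: 'a \<Rightarrow>\<^sub>L 'a) = 0"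
    "scale_op c (U + V) = scale_op c U + scale_op c V" for U V :: "'a \<Rightarrow>\<^sub>L 'a"
    by (auto intro!: blinfun_eqI simp: scale_op.rep_eq blinfun.add_left scaleC_add_right
        scaleC_zero_right)
  show ?thesis
    using True by (induction rule: finite_induct) (auto simp: add)
next
  case False
  then show ?thesis
    by (auto intro!: blinfun_eqI simp: scale_op.rep_eq scaleC_zero_right)
qed

lemma op_poly_smult: "op_poly (smult c q) T = scale_op c (op_poly q T)"
proof -
  have "scale_op (c * d) S = scale_op c (scale_op d S)" for d and S :: "'a \<Rightarrow>\<^sub>L 'a"
    by (rule blinfun_eqI) (simp add: scale_op.rep_eq scaleC_scaleC)
  then show ?thesis
    using op_poly_eq_sum[of "smult c q" "degree q" T] op_poly_eq_sum[of q "degree q" T]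
    by (simp add: scale_op_sum degree_smult_le)
qed

lemma op_poly_0: "op_poly 0 T = 0"
  using op_poly_add[of 0 0 T] by simp

lemma op_poly_diff: "op_poly (p - q) T = op_poly p T - op_poly q T"
  by (metis add_diff_cancel_right' diff_add_cancel op_poly_add)

lemma op_poly_pCons:
  assumes "T \<in> bounded_ops"
  shows "op_poly (pCons a q) T = scale_op a id_blinfun + (T o\<^sub>L op_poly q T)"
proof -
  have "op_poly (pCons a q) T
      = (\<Sum>i\<le>Suc (degree q). scale_op (coeff (pCons a q) i) (op_power T i))"
    by (rule op_poly_eq_sum) (simp add: degree_pCons_le)
  also have "\<dots> = scale_op a id_blinfun + (\<Sum>i\<le>degree q. scale_op (coeff q i) (T o\<^sub>L op_power T i))"
    by (subst sum.atMost_Suc_shift) simp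
  also have "(\<Sum>i\<le>degree q. scale_op (coeff q i) (T o\<^sub>L op_power T i)) = T o\<^sub>L op_poly q T"
    unfolding op_poly_def
    by (rule blinfun_eqI) (simp add: blinfun.sum_left blinfun.sum_right scale_op.rep_eq
        bounded_opsD[OF assms])
  finally show ?thesis .
qed

lemma op_poly_const: "op_poly [:a:] T = scale_op a id_blinfun"
  by (simp add: op_poly_def)

lemma bounded_ops_op_poly: "T \<in> bounded_ops \<Longrightarrow> op_poly q T \<in> bounded_ops"
proof (induction q)
  case 0
  have "0 \<in> bounded_ops"
    by (simp add: bounded_ops_def scaleC_zero_right)
  then show ?case
    by (simp add: op_poly_0)
qed (simp add: op_poly_pCons bounded_ops_add bounded_ops_scale_op bounded_ops_id
    bounded_ops_compose)

text \<open>
  Intertwining passes from \<open>M\<close> and \<open>M'\<close> to polynomials in them, hence below to limits of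
  polynomials. For \<open>M = M'\<close> this is the statement about commuting operators.
\<close>

lemma op_poly_intertwine:
  assumes ops: "X \<in> bounded_ops" "M \<in> bounded_ops" "M' \<in> bounded_ops"
    and XM: "X o\<^sub>L M = M' o\<^sub>L X"
  shows "X o\<^sub>L op_poly q M = op_poly q M' o\<^sub>L X"
proof (induction q)
  case (pCons a q)
  have "X (M x) = M' (X x)" "X (op_poly q M x) = op_poly q M' (X x)" for x
    using XM pCons.IH by (metis blinfun_apply_blinfun_compose)+
  then show ?case
    by (intro blinfun_eqI) (simp add: op_poly_pCons ops blinfun.add_left blinfun.add_right
        scale_op.rep_eq bounded_opsD[OF ops(1)])
qed (simp add: op_poly_0)

lemma op_poly_commute: "M \<in> bounded_ops \<Longrightarrow> M o\<^sub>L op_poly q M = op_poly q M o\<^sub>L M"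
  by (rule op_poly_intertwine) simp_all

lemma op_poly_mult:
  assumes "M \<in> bounded_ops"
  shows "op_poly (p * q) M = op_poly p M o\<^sub>L op_poly q M"
proof (induction p)
  case (pCons a p)
  show ?case
    unfolding mult_pCons_left op_poly_add op_poly_smult op_poly_pCons[OF assms] pCons.IH
    by (intro blinfun_eqI) (simp add: blinfun.add_left scale_op.rep_eq scaleC_zero_left)
qed (simp add: op_poly_0)

lemma op_poly_adjoint:
  assumes M: "M \<in> bounded_ops" and pos: "positive_op M"
  shows "cinner (blinfun_apply (op_poly q M) x) y
    = cinner x (blinfun_apply (op_poly (map_poly cnj q) M) y)"
proof (induction q arbitrary: x y)
  case (pCons a q)
  have "op_poly q M (M x) = M (op_poly q M x)" for q x
    using op_poly_commute[OF M] by (metis blinfun_apply_blinfun_compose)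
  then show ?case
    by (simp add: map_poly_pCons op_poly_pCons M blinfun.add_left scale_op.rep_eq pCons.IH
        cinner_add_left cinner_add_right cinner_scaleC_left cinner_scaleC_right
        positive_op_symmetric[OF M pos])
qed (simp add: op_poly_0 cinner.zero_left cinner.zero_right)

section \<open>Invertibility and the spectral mapping theorem for polynomials\<close>

definition invertible_op :: "('a :: chilbert_space \<Rightarrow>\<^sub>L 'a) \<Rightarrow> bool" where
  "invertible_op N \<longleftrightarrow> (\<exists>S \<in> bounded_ops. S o\<^sub>L N = id_blinfun \<and> N o\<^sub>L S = id_blinfun)"

lemma op_spectrum_iff: "z \<in> op_spectrum T \<longleftrightarrow> \<not> invertible_op (T - scale_op z id_blinfun)"
  by (simp add: op_spectrum_def invertible_op_def)

lemma invertible_op_compose: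
  assumes "invertible_op U" "invertible_op V"
  shows "invertible_op (U o\<^sub>L V)"
proof -
  obtain U' where U': "U' \<in> bounded_ops" "U' o\<^sub>L U = id_blinfun" "U o\<^sub>L U' = id_blinfun"
    using assms(1) unfolding invertible_op_def by blast
  obtain V' where V': "V' \<in> bounded_ops" "V' o\<^sub>L V = id_blinfun" "V o\<^sub>L V' = id_blinfun"
    using assms(2) unfolding invertible_op_def by blast
  have "U' (U x) = x" "U (U' x) = x" "V' (V x) = x" "V (V' x) = x" for x
    using U' V' by (metis blinfun_apply_blinfun_compose blinfun_apply_id_blinfun)+
  then show ?thesis
    unfolding invertible_op_def using U'(1) V'(1)
    by (intro bexI[of _ "V' o\<^sub>L U'"]) (auto intro!: blinfun_eqI simp: bounded_ops_compose)
qed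

text \<open>
  One half of the spectral mapping theorem, in contrapositive form: over the complex numbers \<open>q\<close>
  splits into linear factors, and the factor at each root is an invertible operator.
\<close>

lemma op_poly_invertible:
  assumes M: "M \<in> bounded_ops" and "q \<noteq> 0"
    and "\<And>z. poly q z = 0 \<Longrightarrow> z \<notin> op_spectrum M"
  shows "invertible_op (op_poly q M)"
  using assms(2,3)
proof (induction "degree q" arbitrary: q)
  case 0
  then obtain a where a: "q = [:a:]" "a \<noteq> 0"
    by (metis degree_eq_zeroE pCons_0_0)
  show ?case
    unfolding invertible_op_def a op_poly_const using a(2)
    by (intro bexI[of _ "scale_op (1 / a) id_blinfun"] conjI blinfun_eqI)
      (simp_all add: scale_op.rep_eq scaleC_scaleC scaleC_one bounded_ops_scale_op bounded_ops_id)
next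
  case (Suc d)
  then have "\<not> constant (poly q)"
    by (simp add: constant_degree)
  then obtain z where z: "poly q z = 0"
    using fundamental_theorem_of_algebra by blast
  then obtain r where r: "q = [:- z, 1:] * r"
    by (metis dvdE poly_eq_0_iff_dvd)
  have r0: "r \<noteq> 0"
    using Suc.prems(1) r by auto
  have "op_poly [:- z, 1:] M = M - scale_op z id_blinfun"
    by (intro blinfun_eqI)
      (simp add: op_poly_pCons M op_poly_0 blinfun.add_left blinfun.diff_left scale_op.rep_eq
        scaleC_one scaleC_minus_left)
  then have "invertible_op (op_poly [:- z, 1:] M)"
    using Suc.prems(2)[OF z] by (simp add: op_spectrum_iff)
  moreover have "invertible_op (op_poly r M)"
  proof (rule Suc.hyps(1)[OF _ r0])
    have "degree q = degree [:- z, 1:] + degree r"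
      unfolding r using r0 by (intro degree_mult_eq) auto
    then show "d = degree r"
      using Suc.hyps(2) by simp
    show "w \<notin> op_spectrum M" if "poly r w = 0" for w
      using that Suc.prems(2)[of w] by (simp add: r)
  qed
  ultimately show ?case
    unfolding r op_poly_mult[OF M] by (rule invertible_op_compose)
qed

section \<open>The norm of a polynomial in a positive operator\<close>

text \<open>
  Here \<open>N'\<close> is the adjoint of \<open>N\<close>, and \<open>(norm N)\<^sup>2\<close> is an approximate eigenvalue of \<open>N' N\<close>. If
  \<open>x\<close> is a unit vector for which \<open>norm (N x)\<close> is close to \<open>c = norm N\<close>, then expanding the square shows that
  \<open>N' (N x) - c\<^sup>2 x\<close> is small. An inverse \<open>S\<close> would therefore keep \<open>norm (N x)\<close> uniformly
  below \<open>c\<close> on the unit sphere.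
\<close>

lemma norm_sq_not_invertible:
  fixes N N' :: "'a :: chilbert_space \<Rightarrow>\<^sub>L 'a"
  assumes N0: "N \<noteq> 0"
    and adj: "\<And>x y. cinner (blinfun_apply N x) y = cinner x (blinfun_apply N' y)"
  shows "\<not> invertible_op ((N' o\<^sub>L N) - scale_op (of_real ((norm N)\<^sup>2)) id_blinfun)"
proof
  define c where "c = norm N"
  define P where "P = (N' o\<^sub>L N) - scale_op (of_real (c\<^sup>2)) id_blinfun"
  assume "invertible_op ((N' o\<^sub>L N) - scale_op (of_real ((norm N)\<^sup>2)) id_blinfun)"
  then obtain S where "S o\<^sub>L P = id_blinfun"
    unfolding invertible_op_def P_def c_def by blast
  then have S: "S (P x) = x" for x
    by (metis blinfun_apply_blinfun_compose blinfun_apply_id_blinfun)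
  have c: "c > 0"
    using N0 by (simp add: c_def)
  have normN: "norm (N x) \<le> c * norm x" for x
    unfolding c_def by (rule norm_blinfun)
  have normN': "norm (N' x) \<le> c * norm x" for x
  proof -
    have "(norm (N' x))\<^sup>2 = cmod (cinner (N (N' x)) x)"
      by (simp add: adj cinner_self del: of_real_power)
    also have "\<dots> \<le> norm (N (N' x)) * norm x"
      by (rule cauchy_schwarz)
    also have "\<dots> \<le> c * norm (N' x) * norm x"
      by (intro mult_right_mono normN) simp
    finally show ?thesis
      by (cases "norm (N' x) = 0") (use c in \<open>auto simp: power2_eq_square mult_ac\<close>)
  qed
  have P_le: "(norm (P x))\<^sup>2 \<le> c\<^sup>2 * (c\<^sup>2 * (norm x)\<^sup>2 - (norm (N x))\<^sup>2)" for x
  proof -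
    have "P x = N' (N x) - of_real (c\<^sup>2) *\<^sub>C x"
      by (simp add: P_def blinfun.diff_left scale_op.rep_eq del: of_real_power)
    moreover have "cinner (N' (N x)) x = of_real ((norm (N x))\<^sup>2)"
      unfolding cinner_commute[of "N' (N x)" x] adj[of x "N x", symmetric] cinner_self
      by (rule complex_cnj_complex_of_real)
    ultimately have "(norm (P x))\<^sup>2 = (norm (N' (N x)))\<^sup>2 - 2 * c\<^sup>2 * (norm (N x))\<^sup>2
        + (c\<^sup>2)\<^sup>2 * (norm x)\<^sup>2"
      by (simp add: norm_diff_scaleC_sq norm_power flip: of_real_mult of_real_power)
    moreover have "(norm (N' (N x)))\<^sup>2 \<le> (c * norm (N x))\<^sup>2"
      by (intro power_mono normN') simp
    ultimately show ?thesis
      by (simp add: power_mult_distrib algebra_simps power2_eq_square)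
  qed
  \<comment> \<open>The second summand makes \<open>s\<close> positive and \<open>c\<^sup>2 - 1 / s\<close> nonnegative.\<close>
  define s where "s = (norm S)\<^sup>2 * c\<^sup>2 + 1 / c\<^sup>2"
  have s: "s > 0" "s * c\<^sup>2 \<ge> 1"
    using c by (simp_all add: s_def add_nonneg_pos distrib_right)
  have gap: "(norm (N x))\<^sup>2 \<le> (c\<^sup>2 - 1 / s) * (norm x)\<^sup>2" for x
  proof -
    have "(norm x)\<^sup>2 \<le> (norm S * norm (P x))\<^sup>2"
      by (intro power_mono) (metis S norm_blinfun, simp)
    also have "\<dots> \<le> (norm S)\<^sup>2 * (c\<^sup>2 * (c\<^sup>2 * (norm x)\<^sup>2 - (norm (N x))\<^sup>2))"
      unfolding power_mult_distrib by (intro mult_left_mono P_le) simp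
    also have "\<dots> \<le> s * (c\<^sup>2 * (norm x)\<^sup>2 - (norm (N x))\<^sup>2)"
    proof -
      have "(norm (N x))\<^sup>2 \<le> (c * norm x)\<^sup>2"
        by (intro power_mono normN) simp
      then have "0 \<le> 1 / c\<^sup>2 * (c\<^sup>2 * (norm x)\<^sup>2 - (norm (N x))\<^sup>2)"
        by (intro mult_nonneg_nonneg) (simp_all add: power_mult_distrib)
      then show ?thesis
        unfolding s_def by (simp only: distrib_right mult.assoc)
    qed
    finally have "(norm x)\<^sup>2 / s \<le> c\<^sup>2 * (norm x)\<^sup>2 - (norm (N x))\<^sup>2"
      using s by (simp add: pos_divide_le_eq mult.commute)
    then show ?thesis
      by (simp add: left_diff_distrib)
  qed
  have "c \<le> sqrt (c\<^sup>2 - 1 / s)"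
    unfolding c_def
  proof (rule norm_blinfun_bound, fold c_def)
    show "0 \<le> sqrt (c\<^sup>2 - 1 / s)"
      using s by (simp add: pos_divide_le_eq mult.commute)
    show "norm (N x) \<le> sqrt (c\<^sup>2 - 1 / s) * norm x" for x
      using real_le_rsqrt[OF gap[of x]] by (simp add: real_sqrt_mult)
  qed
  then have "c\<^sup>2 \<le> c\<^sup>2 - 1 / s"
    using c sqrt_ge_absD[of c] by simp
  then show False
    using s by (simp add: field_simps)
qed

text \<open>
  With \<open>c = norm (op_poly q M)\<close>, the polynomial \<open>r = cnj q * q - c\<^sup>2\<close> in \<open>M\<close> is not invertible, so \<open>r\<close> has
  a root in the spectrum. This root is real, whence \<open>cnj q * q\<close> takes there the value
  \<open>(cmod (poly q \<mu>))\<^sup>2\<close>. The degree hypothesis excludes \<open>r = 0\<close>.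
\<close>

lemma op_poly_norm_attained_nonconst:
  assumes M: "M \<in> bounded_ops" and pos: "positive_op M"
    and nz: "op_poly q M \<noteq> 0" and deg: "degree q > 0"
  shows "\<exists>\<mu> \<in> op_spectrum M. norm (op_poly q M) = cmod (poly q \<mu>)"
proof -
  define N where "N = op_poly q M"
  define r where "r = map_poly cnj q * q - [:of_real ((norm N)\<^sup>2):]"
  have "op_poly r M = (op_poly (map_poly cnj q) M o\<^sub>L N) - scale_op (of_real ((norm N)\<^sup>2)) id_blinfun"
    unfolding r_def op_poly_diff op_poly_mult[OF M] op_poly_const N_def ..
  then have not_inv: "\<not> invertible_op (op_poly r M)"
    using norm_sq_not_invertible[of N "op_poly (map_poly cnj q) M"] nz op_poly_adjoint[OF M pos]
    by (simp add: N_def)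
  have "degree (map_poly cnj q) = degree q"
    by (simp add: degree_map_poly)
  then have "degree (map_poly cnj q * q) > 0"
    using deg by (subst degree_mult_eq) auto
  then have "r \<noteq> 0"
    unfolding r_def by (metis degree_pCons_0 eq_iff_diff_eq_0 less_numeral_extra(3))
  then obtain \<mu> where \<mu>: "poly r \<mu> = 0" "\<mu> \<in> op_spectrum M"
    using op_poly_invertible[OF M, of r] not_inv by blast
  obtain t where t: "\<mu> = of_real t"
    using op_spectrum_positive[OF M pos] \<mu>(2) by blast
  have "poly (map_poly cnj q) \<mu> = cnj (poly q \<mu>)"
    unfolding poly_cnj t complex_cnj_complex_of_real ..
  then have "of_real ((norm N)\<^sup>2) = complex_of_real ((cmod (poly q \<mu>))\<^sup>2)"
    using \<mu>(1) unfolding r_def complex_norm_square by (simp add: mult.commute)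
  then have "norm N = cmod (poly q \<mu>)"
    by (simp del: of_real_power)
  then show ?thesis
    using \<mu>(2) by (auto simp: N_def)
qed

text \<open>
  Applied to the nonconstant polynomial \<open>1 + z\<close>, whose value at a positive operator is nonzero, the
  previous lemma produces a point of the spectrum.
\<close>

lemma op_spectrum_nonempty:
  fixes M :: "'a :: chilbert_space \<Rightarrow>\<^sub>L 'a"
  assumes M: "M \<in> bounded_ops" and pos: "positive_op M" and x: "(x :: 'a) \<noteq> 0"
  shows "op_spectrum M \<noteq> {}"
proof -
  have "op_poly [:1, 1:] M x = x + M x"
    by (simp add: op_poly_pCons M op_poly_0 blinfun.add_left scale_op.rep_eq scaleC_one)
  moreover have "x + M x \<noteq> 0"
  proof
    assume "x + M x = 0"
    then have "Re (cinner x (x + M x)) = 0"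
      by (simp add: cinner.zero_right)
    then show False
      using positive_opD(2)[OF pos, of x] x
      by (simp add: cinner_add_right cinner_self add_nonneg_eq_0_iff del: of_real_power)
  qed
  ultimately have "op_poly [:1, 1:] M \<noteq> 0"
    by (metis zero_blinfun.rep_eq)
  then show ?thesis
    using op_poly_norm_attained_nonconst[OF M pos, of "[:1, 1:]"] by auto
qed

text \<open>
  The estimate that makes the continuous functional calculus work: uniform closeness of polynomials
  on the spectrum gives closeness in operator norm.
\<close>

lemma norm_op_poly_le:
  fixes M :: "'a :: chilbert_space \<Rightarrow>\<^sub>L 'a"
  assumes M: "M \<in> bounded_ops" and pos: "positive_op M" and e: "0 \<le> e"
    and bound: "\<And>\<mu>. \<mu> \<in> op_spectrum M \<Longrightarrow> cmod (poly q \<mu>) \<le> e"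
  shows "norm (op_poly q M) \<le> e"
proof (cases "op_poly q M = 0")
  case nz: False
  show ?thesis
  proof (cases "degree q = 0")
    case True
    then obtain a where a: "q = [:a:]"
      by (metis degree_eq_zeroE)
    obtain x :: 'a where "x \<noteq> 0"
      using nz by (metis blinfun_eqI blinfun.zero_right zero_blinfun.rep_eq)
    then obtain \<mu> where "\<mu> \<in> op_spectrum M"
      using op_spectrum_nonempty[OF M pos] by blast
    then have "cmod a \<le> e"
      using bound by (force simp: a)
    then show ?thesis
      unfolding a op_poly_const
      by (intro norm_blinfun_bound e) (simp add: scale_op.rep_eq norm_scaleC mult_right_mono)
  next
    case False
    then show ?thesis
      using op_poly_norm_attained_nonconst[OF M pos nz] bound by force
  qed
qed (simp add: e)

section \<open>Continuous functions of a positive operator\<close>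

text \<open>
  By the norm estimate, \<open>op_poly (q n) M\<close> is Cauchy and any other approximating sequence of
  polynomials has the same limit. The existence of one approximating sequence is what makes the
  description in the definition of \<^const>\<open>op_cfc\<close> unique.
\<close>

lemma op_cfc_limit:
  fixes M :: "'a :: chilbert_space \<Rightarrow>\<^sub>L 'a"
  assumes M: "M \<in> bounded_ops" and pos: "positive_op M"
    and q: "uniform_limit (op_spectrum M) (\<lambda>n. poly (q n)) f sequentially"
  shows "(\<lambda>n. op_poly (q n) M) \<longlonglongrightarrow> op_cfc f M"
proof -
  have close: "\<exists>N. \<forall>m\<ge>N. \<forall>n\<ge>N. norm (op_poly (q1 m) M - op_poly (q2 n) M) < e"
    if "uniform_limit (op_spectrum M) (\<lambda>n. poly (q1 n)) f sequentially"
      "uniform_limit (op_spectrum M) (\<lambda>n. poly (q2 n)) f sequentially" "e > 0" for q1 q2 and e :: real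
  proof -
    have "\<forall>\<^sub>F n in sequentially. \<forall>z\<in>op_spectrum M. dist (poly (q1 n) z) (f z) < e / 3"
      "\<forall>\<^sub>F n in sequentially. \<forall>z\<in>op_spectrum M. dist (poly (q2 n) z) (f z) < e / 3"
      using that by (intro uniform_limitD; simp)+
    then obtain N1 N2 where
      N: "\<And>n z. n \<ge> N1 \<Longrightarrow> z \<in> op_spectrum M \<Longrightarrow> dist (poly (q1 n) z) (f z) < e / 3"
        "\<And>n z. n \<ge> N2 \<Longrightarrow> z \<in> op_spectrum M \<Longrightarrow> dist (poly (q2 n) z) (f z) < e / 3"
      unfolding eventually_sequentially by blast
    have "norm (op_poly (q1 m) M - op_poly (q2 n) M) < e" if "m \<ge> max N1 N2" "n \<ge> max N1 N2" for m n
    proof -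
      have "norm (op_poly (q1 m - q2 n) M) \<le> e / 3 + e / 3"
      proof (rule norm_op_poly_le[OF M pos])
        fix z assume z: "z \<in> op_spectrum M"
        show "cmod (poly (q1 m - q2 n) z) \<le> e / 3 + e / 3"
          using N(1)[of m z] N(2)[of n z] that z
            dist_triangle2[of "poly (q1 m) z" "poly (q2 n) z" "f z"]
          by (simp add: dist_norm)
      qed (use \<open>e > 0\<close> in simp)
      then show ?thesis
        using \<open>e > 0\<close> by (simp add: op_poly_diff)
    qed
    then show ?thesis
      by blast
  qed
  have "Cauchy (\<lambda>n. op_poly (q n) M)"
    using close[OF q q] by (intro CauchyI) blast
  then obtain L where L: "(\<lambda>n. op_poly (q n) M) \<longlonglongrightarrow> L"
    by (metis Cauchy_convergent_iff convergent_def)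
  have "op_cfc f M = L"
    unfolding op_cfc_def
  proof (rule the_equality, intro allI impI)
    fix q' assume q': "uniform_limit (op_spectrum M) (\<lambda>n. poly (q' n)) f sequentially"
    have "(\<lambda>n. op_poly (q' n) M - op_poly (q n) M) \<longlonglongrightarrow> 0"
      by (rule LIMSEQ_I) (use close[OF q' q] in fastforce)
    from tendsto_add[OF this L] show "(\<lambda>n. op_poly (q' n) M) \<longlonglongrightarrow> L"
      by simp
  next
    fix S assume "\<forall>q. uniform_limit (op_spectrum M) (\<lambda>n. poly (q n)) f sequentially
      \<longrightarrow> (\<lambda>n. op_poly (q n) M) \<longlonglongrightarrow> S"
    then show "S = L"
      using q L LIMSEQ_unique by blast
  qed
  then show ?thesis
    using L by simp
qed

text \<open>
  Weierstrass approximation with real coefficients, which is what makes the approximating operators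
  self-adjoint.
\<close>

lemma uniform_poly_approximation:
  fixes g :: "real \<Rightarrow> real"
  assumes g: "continuous_on {0..K} g"
  shows "\<exists>Q :: nat \<Rightarrow> complex poly. (\<forall>n. map_poly cnj (Q n) = Q n) \<and>
    uniform_limit (complex_of_real ` {0..K}) (\<lambda>n. poly (Q n)) (\<lambda>z. of_real (g (Re z))) sequentially"
proof -
  have "\<exists>P :: real poly. \<forall>t\<in>{0..K}. \<bar>g t - poly P t\<bar> < 1 / real (Suc n)" for n
  proof -
    obtain h where h: "real_polynomial_function h" "\<And>t. t \<in> {0..K} \<Longrightarrow> \<bar>g t - h t\<bar> < 1 / real (Suc n)"
      using Stone_Weierstrass_real_polynomial_function[OF compact_Icc g, of "1 / real (Suc n)"] by auto
    obtain a m where "h = (\<lambda>x. \<Sum>i\<le>m. a i * x ^ i)"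
      using h(1) unfolding real_polynomial_function_iff_sum by blast
    then have "h t = poly (\<Sum>i\<le>m. monom (a i) i) t" for t
      by (simp add: poly_sum poly_monom)
    then show ?thesis
      using h(2) by metis
  qed
  then obtain P :: "nat \<Rightarrow> real poly" where
    P: "\<And>n t. t \<in> {0..K} \<Longrightarrow> \<bar>g t - poly (P n) t\<bar> < 1 / real (Suc n)"
    by metis
  define Q where "Q n = map_poly complex_of_real (P n)" for n
  have evalQ: "poly (Q n) (of_real t) = of_real (poly (P n) t)" for n t
    unfolding Q_def by (simp add: poly_altdef degree_map_poly coeff_map_poly)
  have "map_poly cnj (Q n) = Q n" for n
    by (simp add: Q_def poly_eq_iff coeff_map_poly)
  moreover have "uniform_limit (complex_of_real ` {0..K}) (\<lambda>n. poly (Q n)) (\<lambda>z. of_real (g (Re z)))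
      sequentially"
  proof (rule uniform_limitI)
    fix e :: real assume "e > 0"
    then obtain N where N: "1 / real (Suc N) < e"
      using reals_Archimedean[of e] by (auto simp: inverse_eq_divide)
    have "dist (poly (Q n) z) (of_real (g (Re z))) < e" if n: "n \<ge> N" and z: "z \<in> complex_of_real ` {0..K}" for n z
    proof -
      obtain t where t: "z = of_real t" "t \<in> {0..K}"
        using z by blast
      have "1 / real (Suc n) \<le> 1 / real (Suc N)"
        using n by (intro divide_left_mono) auto
      then show ?thesis
        using P[OF t(2), of n] N
        by (simp add: t(1) evalQ dist_norm norm_minus_commute flip: of_real_diff)
    qed
    then show "\<forall>\<^sub>F n in sequentially. \<forall>z\<in>complex_of_real ` {0..K}.
        dist (poly (Q n) z) (of_real (g (Re z))) < e"
      unfolding eventually_sequentially by blast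
  qed
  ultimately show ?thesis
    by blast
qed

lemma continuous_on_powr_Icc: "p > 0 \<Longrightarrow> continuous_on {0..K} (\<lambda>t::real. t powr p)"
  by (intro continuous_on_powr' continuous_intros) auto

text \<open>
  One sequence of polynomials approximates the power function on an interval that contains both
  spectra, so the intertwining relation passes to the limit.
\<close>

lemma op_powr_intertwine:
  assumes p: "p > 0" and X: "X \<in> bounded_ops"
    and M: "M \<in> bounded_ops" "positive_op M" and M': "M' \<in> bounded_ops" "positive_op M'"
    and XM: "X o\<^sub>L M = M' o\<^sub>L X"
  shows "X o\<^sub>L op_powr M p = op_powr M' p o\<^sub>L X"
proof -
  define K where "K = max (norm M) (norm M')"
  obtain q where q: "uniform_limit (complex_of_real ` {0..K}) (\<lambda>n. poly (q n))
      (\<lambda>z. of_real (Re z powr p)) sequentially"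
    using uniform_poly_approximation[OF continuous_on_powr_Icc[OF p]] by blast
  have sub: "op_spectrum M \<subseteq> of_real ` {0..K}" "op_spectrum M' \<subseteq> of_real ` {0..K}"
    by (rule order_trans[OF op_spectrum_positive image_mono]; simp add: M M' K_def)+
  note lim = op_cfc_limit[OF M uniform_limit_on_subset[OF q sub(1)], folded op_powr_def]
    op_cfc_limit[OF M' uniform_limit_on_subset[OF q sub(2)], folded op_powr_def]
  note compose = bounded_bilinear.tendsto[OF bounded_bilinear_blinfun_compose]
  have "(\<lambda>n. X o\<^sub>L op_poly (q n) M) \<longlonglongrightarrow> (X o\<^sub>L op_powr M p)"
    by (rule compose[OF tendsto_const lim(1)])
  moreover have "(\<lambda>n. X o\<^sub>L op_poly (q n) M) \<longlonglongrightarrow> (op_powr M' p o\<^sub>L X)"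
    unfolding op_poly_intertwine[OF X M(1) M'(1) XM] by (rule compose[OF lim(2) tendsto_const])
  ultimately show ?thesis
    by (rule LIMSEQ_unique)
qed

lemma bounded_ops_op_powr:
  assumes p: "p > 0" and M: "M \<in> bounded_ops" "positive_op M"
  shows "op_powr M p \<in> bounded_ops"
proof -
  obtain q where q: "uniform_limit (complex_of_real ` {0..norm M}) (\<lambda>n. poly (q n))
      (\<lambda>z. of_real (Re z powr p)) sequentially"
    using uniform_poly_approximation[OF continuous_on_powr_Icc[OF p]] by blast
  have "(\<lambda>n. op_poly (q n) M) \<longlonglongrightarrow> op_powr M p"
    unfolding op_powr_def
    by (rule op_cfc_limit[OF M uniform_limit_on_subset[OF q op_spectrum_positive[OF M]]])
  then show ?thesis
    by (rule closed_sequentially[OF closed_bounded_ops bounded_ops_op_poly[OF M(1)]])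
qed

text \<open>
  If \<open>R\<close> is a self-adjoint square root of \<open>M\<close> that commutes with \<open>P\<close>, then
  \<open>cinner x (M (P x)) = cinner (R x) (P (R x))\<close>. Polynomials in \<open>M\<close> that approximate the square
  root serve as approximate \<open>R\<close>.
\<close>

lemma positive_op_compose_commuting:
  assumes M: "M \<in> bounded_ops" "positive_op M" and P: "P \<in> bounded_ops" "positive_op P"
    and comm: "P o\<^sub>L M = M o\<^sub>L P"
  shows "positive_op (M o\<^sub>L P)"
proof -
  define J where "J = complex_of_real ` {0..norm M}"
  obtain q where real_q: "\<And>n. map_poly cnj (q n) = q n"
    and q: "uniform_limit J (\<lambda>n. poly (q n)) (\<lambda>z. of_real (sqrt (Re z))) sequentially"
    using uniform_poly_approximation[OF continuous_on_real_sqrt[OF continuous_on_id]]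
    unfolding J_def by blast
  have bounded: "bounded ((\<lambda>z. complex_of_real (sqrt (Re z))) ` J)"
    unfolding J_def
    by (intro compact_imp_bounded compact_continuous_image continuous_intros compact_Icc)
  have "uniform_limit J (\<lambda>n z. poly (q n) z * poly (q n) z)
      (\<lambda>z. of_real (sqrt (Re z)) * of_real (sqrt (Re z))) sequentially"
    by (rule uniform_lim_mult[OF q q bounded bounded])
  moreover have "complex_of_real (sqrt (Re z)) * of_real (sqrt (Re z)) = z" if "z \<in> J" for z
    using that by (auto simp: J_def simp flip: of_real_mult)
  ultimately have "uniform_limit J (\<lambda>n. poly (q n * q n)) (\<lambda>z. z) sequentially"
    by (simp cong: uniform_limit_cong')
  then have "uniform_limit (op_spectrum M) (\<lambda>n. poly (q n * q n)) (\<lambda>z. z) sequentially"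
    using op_spectrum_positive[OF M] unfolding J_def by (rule uniform_limit_on_subset)
  then have sq: "(\<lambda>n. op_poly (q n * q n) M) \<longlonglongrightarrow> op_cfc (\<lambda>z. z) M"
    by (rule op_cfc_limit[OF M])
  have "(\<lambda>n. op_poly [:0, 1:] M) \<longlonglongrightarrow> op_cfc (\<lambda>z. z) M"
    by (rule op_cfc_limit[OF M]) (auto intro!: uniform_limitI)
  moreover have "op_poly [:0, 1:] M = M"
    by (intro blinfun_eqI) (simp add: op_poly_pCons M op_poly_0 blinfun.add_left scale_op.rep_eq
        scaleC_zero_left scaleC_one blinfun.zero_right)
  ultimately have id: "op_cfc (\<lambda>z. z) M = M"
    by (simp add: LIMSEQ_const_iff)
  show ?thesis
    unfolding positive_op_def
  proof
    fix x
    have "cinner x (op_poly (q n * q n) M (P x)) = cinner (op_poly (q n) M x) (P (op_poly (q n) M x))" for n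
    proof -
      have "P (op_poly (q n) M x) = op_poly (q n) M (P x)"
        by (intro compose_eq_apply op_poly_intertwine P M comm)
      then show ?thesis
        using op_poly_adjoint[OF M, of "q n"] by (simp add: op_poly_mult[OF M(1)] real_q)
    qed
    then have "cinner x (op_poly (q n * q n) M (P x)) \<in> \<real>\<^sub>\<ge>\<^sub>0" for n
      using P(2) by (simp add: positive_op_def)
    moreover have "(\<lambda>n. cinner x (op_poly (q n * q n) M (P x))) \<longlonglongrightarrow> cinner x (M (P x))"
      by (intro cinner.tendsto tendsto_const blinfun.tendsto sq[unfolded id])
    ultimately have "cinner x (M (P x)) \<in> \<real>\<^sub>\<ge>\<^sub>0"
      by (rule closed_sequentially[OF closed_nonneg_Reals_complex])
    then show "cinner x ((M o\<^sub>L P) x) \<in> \<real>\<^sub>\<ge>\<^sub>0"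
      by simp
  qed
qed

section \<open>Transfer of quasihyponormality along an intertwiner\<close>

lemma op_power_intertwine: "X o\<^sub>L M = M' o\<^sub>L X \<Longrightarrow> X o\<^sub>L op_power M k = op_power M' k o\<^sub>L X"
proof (induction k)
  case (Suc k)
  show ?case
    using Suc.IH[OF Suc.prems, THEN compose_eq_apply] compose_eq_apply[OF Suc.prems]
    by (intro blinfun_eqI) simp
qed (auto intro!: blinfun_eqI)

lemma op_power_Suc_right: "op_power T (Suc k) = op_power T k o\<^sub>L T"
  using op_power_intertwine[of T T T k] by simp

lemma op_power_adjoint:
  assumes "T \<in> bounded_ops"
  shows "cinner x (blinfun_apply (op_power (hadjoint T) k) y) = cinner (blinfun_apply (op_power T k) x) y"
proof (induction k arbitrary: x)
  case (Suc k)
  then show ?case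
    unfolding op_power_Suc_right[of T] using assms by (simp add: cinner_hadjoint_right)
qed simp

text \<open>
  This operator is named because what is transferred between \<open>T\<close> and \<open>S\<close> is an identity between the
  operators themselves, from which their positivity is then compared.
\<close>

definition hyponormality_form :: "real \<Rightarrow> nat \<Rightarrow> ('a :: chilbert_space \<Rightarrow>\<^sub>L 'a) \<Rightarrow> ('a \<Rightarrow>\<^sub>L 'a)" where
  "hyponormality_form p k T = op_power (hadjoint T) k o\<^sub>L
      (op_powr (hadjoint T o\<^sub>L T) p - op_powr (T o\<^sub>L hadjoint T) p) o\<^sub>L op_power T k"

text \<open>
  Both relations are required because the hyponormality form is built from \<open>T\<close> and its adjoint; they
  also make the notion symmetric under passing to the adjoint of \<open>X\<close>.
\<close>

definition intertwines :: "('a :: chilbert_space \<Rightarrow>\<^sub>L 'a) \<Rightarrow> ('a \<Rightarrow>\<^sub>L 'a) \<Rightarrow> ('a \<Rightarrow>\<^sub>L 'a) \<Rightarrow> bool" where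
  "intertwines X T S \<longleftrightarrow> X o\<^sub>L T = S o\<^sub>L X \<and> X o\<^sub>L hadjoint T = hadjoint S o\<^sub>L X"

lemma intertwines_hadjoint:
  assumes "X \<in> bounded_ops" "T \<in> bounded_ops" "S \<in> bounded_ops" "intertwines X T S"
  shows "intertwines (hadjoint X) S T"
proof -
  have "hadjoint (X o\<^sub>L T) = hadjoint (S o\<^sub>L X)"
    "hadjoint (X o\<^sub>L hadjoint T) = hadjoint (hadjoint S o\<^sub>L X)"
    using assms(4) by (simp_all add: intertwines_def)
  then show ?thesis
    using assms(1-3)
    by (simp add: intertwines_def hadjoint_compose hadjoint_in_bounded_ops hadjoint_hadjoint)
qed

lemma positive_compose_hadjoint: "T \<in> bounded_ops \<Longrightarrow> positive_op (T o\<^sub>L hadjoint T)"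
  using positive_hadjoint_compose[OF hadjoint_in_bounded_ops] by (metis hadjoint_hadjoint)

lemma hyponormality_form_intertwine:
  assumes p: "p > 0" and ops: "X \<in> bounded_ops" "T \<in> bounded_ops" "S \<in> bounded_ops"
    and XTS: "intertwines X T S"
  shows "X o\<^sub>L hyponormality_form p k T = hyponormality_form p k S o\<^sub>L X"
proof -
  have X1: "X o\<^sub>L T = S o\<^sub>L X" and X2: "X o\<^sub>L hadjoint T = hadjoint S o\<^sub>L X"
    using XTS by (simp_all add: intertwines_def)
  note app = compose_eq_apply[OF X1] compose_eq_apply[OF X2]
  note mem = bounded_ops_compose hadjoint_in_bounded_ops ops
    positive_hadjoint_compose positive_compose_hadjoint
  have "X o\<^sub>L op_powr (hadjoint T o\<^sub>L T) p = op_powr (hadjoint S o\<^sub>L S) p o\<^sub>L X"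
    "X o\<^sub>L op_powr (T o\<^sub>L hadjoint T) p = op_powr (S o\<^sub>L hadjoint S) p o\<^sub>L X"
    by (intro op_powr_intertwine p blinfun_eqI; simp add: mem app)+
  note this[THEN compose_eq_apply] op_power_intertwine[OF X1, THEN compose_eq_apply, of k]
    op_power_intertwine[OF X2, THEN compose_eq_apply, of k]
  then show ?thesis
    by (intro blinfun_eqI) (simp add: hyponormality_form_def blinfun.diff_left blinfun.diff_right)
qed

lemma bounded_ops_hyponormality_form:
  "p > 0 \<Longrightarrow> T \<in> bounded_ops \<Longrightarrow> hyponormality_form p k T \<in> bounded_ops"
  unfolding hyponormality_form_def
  by (intro bounded_ops_compose bounded_ops_diff bounded_ops_op_powr bounded_ops_power
      hadjoint_in_bounded_ops positive_hadjoint_compose positive_compose_hadjoint)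

text \<open>
  With \<open>H = X\<^sup>* X\<close>, take \<open>y = (H + e)\<^sup>-\<^sup>1 x\<close>, which exists because \<open>- e\<close> is outside the spectrum of \<open>H\<close>.
  Then \<open>x - H y = e y\<close>, and pairing \<open>x = H y + e y\<close> with \<open>y\<close> bounds the square of the norm of
  \<open>e (X y)\<close> by \<open>e (norm x)\<^sup>2\<close>. So \<open>X (H y)\<close> tends to \<open>X x\<close> although \<open>H y\<close> itself need not
  tend to \<open>x\<close> (it cannot when \<open>x\<close> is a nonzero vector of the kernel of \<open>X\<close>).
\<close>

lemma range_gram_approx:
  assumes X: "X \<in> bounded_ops"
  shows "\<exists>y. (\<lambda>n. blinfun_apply X (blinfun_apply (hadjoint X o\<^sub>L X) (y n))) \<longlonglongrightarrow> blinfun_apply X x"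
proof -
  define H where "H = hadjoint X o\<^sub>L X"
  have H: "H \<in> bounded_ops" "positive_op H"
    unfolding H_def by (simp_all add: X bounded_ops_compose hadjoint_in_bounded_ops
        positive_hadjoint_compose)
  have form: "cinner y (H y) = of_real ((norm (X y))\<^sup>2)" for y
    by (simp add: H_def cinner_hadjoint_right[OF X] cinner_self del: of_real_power)
  have approx: "\<exists>y. (norm (X x - X (H y)))\<^sup>2 \<le> e * (norm x)\<^sup>2" if e: "e > 0" for e
  proof -
    have "of_real (- e) \<notin> op_spectrum H"
      using op_spectrum_positive[OF H] e by fastforce
    then obtain R where "(H - scale_op (of_real (- e)) id_blinfun) o\<^sub>L R = id_blinfun"
      unfolding op_spectrum_iff invertible_op_def by blast
    then have "(H - scale_op (of_real (- e)) id_blinfun) (R x) = x"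
      by (metis blinfun_apply_blinfun_compose blinfun_apply_id_blinfun)
    then have y: "x = H (R x) + e *\<^sub>R R x"
      by (simp add: blinfun.diff_left scale_op.rep_eq scaleC_minus_left scaleR_scaleC)
    define y where "y = R x"
    have "Re (cinner y x) = (norm (X y))\<^sup>2 + e * (norm y)\<^sup>2"
      by (subst y) (simp add: cinner_add_right cinner.scaleR_right form cinner_self y_def
          del: of_real_power)
    then have *: "(norm (X y))\<^sup>2 + e * (norm y)\<^sup>2 \<le> norm y * norm x"
      using complex_Re_le_cmod cauchy_schwarz order_trans by metis
    have "e * (norm y)\<^sup>2 \<le> norm y * norm x"
      using * zero_le_power2[of "norm (X y)"] by linarith
    then have ey: "e * norm y \<le> norm x"
      by (cases "norm y = 0") (auto simp: power2_eq_square)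
    have "(norm (X y))\<^sup>2 \<le> norm y * norm x"
      using * e zero_le_power2[of "norm y"] by (smt (verit) mult_nonneg_nonneg)
    then have "e * (norm (X y))\<^sup>2 \<le> (e * norm y) * norm x"
      using e by simp
    also have "\<dots> \<le> norm x * norm x"
      using ey by (rule mult_right_mono) simp
    finally have "e * (e * (norm (X y))\<^sup>2) \<le> e * (norm x)\<^sup>2"
      using e by (simp add: power2_eq_square)
    moreover have "X x - X (H y) = e *\<^sub>R X y"
      by (subst y) (simp add: blinfun.add_right blinfun.scaleR_right y_def)
    ultimately show ?thesis
      by (intro exI[of _ y]) (use e in \<open>simp add: power_mult_distrib power2_eq_square mult_ac\<close>)
  qed
  have "\<exists>y. (norm (X x - X (H y)))\<^sup>2 \<le> 1 / real (Suc n) * (norm x)\<^sup>2" for n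
    by (rule approx) simp
  then obtain y where y: "\<And>n. (norm (X x - X (H (y n))))\<^sup>2 \<le> 1 / real (Suc n) * (norm x)\<^sup>2"
    by metis
  have "(\<lambda>n. 1 / real (Suc n) * (norm x)\<^sup>2) \<longlonglongrightarrow> 0 * (norm x)\<^sup>2"
    by (intro tendsto_intros LIMSEQ_Suc[OF lim_1_over_n])
  then have lim: "(\<lambda>n. 1 / real (Suc n) * (norm x)\<^sup>2) \<longlonglongrightarrow> 0"
    by (simp only: mult_zero_left)
  have "norm ((norm (X x - X (H (y n))))\<^sup>2) \<le> 1 / real (Suc n) * (norm x)\<^sup>2" for n
    using y[of n] by (simp only: real_norm_def abs_power2)
  then have "(\<lambda>n. (norm (X x - X (H (y n))))\<^sup>2) \<longlonglongrightarrow> 0"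
    by (intro Lim_null_comparison[OF always_eventually lim] allI)
  then have "(\<lambda>n. norm (X x - X (H (y n)))) \<longlonglongrightarrow> 0"
    using tendsto_real_sqrt by fastforce
  then have "(\<lambda>n. X x - X (H (y n))) \<longlonglongrightarrow> 0"
    by (rule tendsto_norm_zero_cancel)
  from tendsto_diff[OF tendsto_const[of "X x"] this] have "(\<lambda>n. X (H (y n))) \<longlonglongrightarrow> X x"
    by simp
  then show ?thesis
    unfolding H_def by blast
qed

text \<open>
  Let \<open>T = Y X\<close>, \<open>H = X\<^sup>* X\<close>, and let \<open>Q\<close> and \<open>Q'\<close> be the hyponormality forms of \<open>T\<close> and \<open>S\<close>. From
  \<open>X Q = Q' X\<close> one gets \<open>H Q = X\<^sup>* Q' X \<ge> 0\<close>, and \<open>H\<close> commutes with \<open>Q\<close>. Multiplying once more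
  by the commuting operator \<open>H\<close> gives \<open>H Q H \<ge> 0\<close>, which is positivity of \<open>Q\<close> on the range of \<open>H\<close>.
  The quadratic form of \<open>Q\<close> at \<open>x\<close> depends only, and continuously, on \<open>X x\<close>, since \<open>T\<^sup>k\<close> with \<open>k > 0\<close>
  ends in the factor \<open>X\<close>; as the vectors \<open>X (H y)\<close> approximate \<open>X x\<close>, positivity extends to every \<open>x\<close>.
\<close>

lemma quasihyponormal_transfer:
  assumes p: "p > 0" and k: "k > 0"
    and ops: "X \<in> bounded_ops" "Y \<in> bounded_ops" "S \<in> bounded_ops"
    and XTS: "intertwines X (Y o\<^sub>L X) S" and S: "quasihyponormal p k S"
  shows "quasihyponormal p k (Y o\<^sub>L X)"
proof -
  define T where "T = Y o\<^sub>L X"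
  define H where "H = hadjoint X o\<^sub>L X"
  define Q where "Q = hyponormality_form p k T"
  have T: "T \<in> bounded_ops"
    unfolding T_def by (intro bounded_ops_compose ops)
  have H: "H \<in> bounded_ops" "positive_op H"
    unfolding H_def by (simp_all add: ops bounded_ops_compose hadjoint_in_bounded_ops
        positive_hadjoint_compose)
  have Q: "Q \<in> bounded_ops"
    unfolding Q_def by (rule bounded_ops_hyponormality_form[OF p T])
  have XTS': "intertwines X T S"
    using XTS by (simp add: T_def)
  have XQ: "X (Q x) = hyponormality_form p k S (X x)" for x
    unfolding Q_def
    by (intro compose_eq_apply hyponormality_form_intertwine p ops T XTS')
  have X'Q: "hadjoint X (hyponormality_form p k S x) = Q (hadjoint X x)" for x
    unfolding Q_def
    by (intro compose_eq_apply hyponormality_form_intertwine intertwines_hadjoint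
        hadjoint_in_bounded_ops p ops T XTS')
  have comm: "H o\<^sub>L Q = Q o\<^sub>L H"
    by (intro blinfun_eqI) (simp add: H_def XQ X'Q)
  have "positive_op (H o\<^sub>L Q)"
    using S unfolding positive_op_def quasihyponormal_def
    by (simp add: H_def cinner_hadjoint_right[OF ops(1)] XQ flip: hyponormality_form_def)
  moreover have "(H o\<^sub>L Q) o\<^sub>L H = H o\<^sub>L (H o\<^sub>L Q)"
    by (intro blinfun_eqI) (simp add: compose_eq_apply[OF comm])
  ultimately have HHQ: "positive_op (H o\<^sub>L (H o\<^sub>L Q))"
    by (rule positive_op_compose_commuting[OF H bounded_ops_compose[OF H(1) Q]])
  have on_range: "cinner (H y) (Q (H y)) \<in> \<real>\<^sub>\<ge>\<^sub>0" for y
  proof -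
    have "cinner (H y) (Q (H y)) = cinner y (H (H (Q y)))"
      by (simp add: positive_op_symmetric[OF H] compose_eq_apply[OF comm])
    then show ?thesis
      using HHQ by (simp add: positive_op_def)
  qed
  define D where "D = op_powr (hadjoint T o\<^sub>L T) p - op_powr (T o\<^sub>L hadjoint T) p"
  define Z where "Z = op_power T (k - 1) o\<^sub>L Y"
  have "op_power T k = op_power T (k - 1) o\<^sub>L T"
    using op_power_Suc_right[of T "k - 1"] k by simp
  then have power: "op_power T k x = Z (X x)" for x
    by (simp add: Z_def T_def)
  have form: "cinner x (Q x) = cinner (Z (X x)) (D (Z (X x)))" for x
    by (simp add: Q_def hyponormality_form_def D_def op_power_adjoint[OF T] power)
  have "cinner x (Q x) \<in> \<real>\<^sub>\<ge>\<^sub>0" for x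
  proof -
    obtain y where y: "(\<lambda>n. X (H (y n))) \<longlonglongrightarrow> X x"
      using range_gram_approx[OF ops(1), of x] unfolding H_def by blast
    note Zy = blinfun.tendsto[OF tendsto_const y, of Z]
    have "(\<lambda>n. cinner (H (y n)) (Q (H (y n)))) \<longlonglongrightarrow> cinner x (Q x)"
      unfolding form by (rule cinner.tendsto[OF Zy blinfun.tendsto[OF tendsto_const Zy]])
    with on_range show ?thesis
      by (rule closed_sequentially[OF closed_nonneg_Reals_complex])
  qed
  then show ?thesis
    by (simp add: quasihyponormal_def positive_op_def Q_def T_def flip: hyponormality_form_def)
qed

theorem theorem2p6:
  fixes A B :: "'a :: chilbert_space \<Rightarrow>\<^sub>L 'a" and p :: real and k :: nat
  assumes "0 < p" and "p \<le> 1" and "0 < k"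
    and "A \<in> bounded_ops" and "B \<in> bounded_ops"
    and "normal_op A"
    and "quasihyponormal p k (A o\<^sub>L B)"
    and "B o\<^sub>L (A o\<^sub>L hadjoint A) = (A o\<^sub>L hadjoint A) o\<^sub>L B"
  shows "quasihyponormal p k (B o\<^sub>L A)"
proof (rule quasihyponormal_transfer)
  have normal: "hadjoint A (A x) = A (hadjoint A x)" for x
    using assms(6) unfolding normal_op_def by (metis blinfun_apply_blinfun_compose)
  \<comment> \<open>The adjoint of the commutation hypothesis: \<open>A A\<^sup>*\<close> commutes with \<open>B\<^sup>*\<close> as well.\<close>
  have "hadjoint (B o\<^sub>L (A o\<^sub>L hadjoint A)) = hadjoint ((A o\<^sub>L hadjoint A) o\<^sub>L B)"
    by (simp only: assms(8))
  then have "A (hadjoint A (hadjoint B x)) = hadjoint B (A (hadjoint A x))" for x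
    using assms(4,5) by (simp add: hadjoint_compose bounded_ops_compose hadjoint_in_bounded_ops
        hadjoint_hadjoint) (metis blinfun_apply_blinfun_compose)
  then show "intertwines A (B o\<^sub>L A) (A o\<^sub>L B)"
    unfolding intertwines_def using assms(4,5)
    by (auto intro!: blinfun_eqI simp: hadjoint_compose normal)
qed (use assms bounded_ops_compose in auto)

end
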